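(* Let $P=(X,\prec)$ be a finite poset and let $N\ge 0$ be an integer. Let $A,B\subseteq X$ be lower ideals and let $C,D\subseteq X$ be upper ideals of $P$ such that $A\cap C=B\cap D=\varnothing$. Set $V:=(A\cap B)\cup(C\cup D)$ and $W:=(A\cup B)\cup(C\cap D)$. Then $$K_{\mathbf z}(X\setminus V,N)\cdot K_{\mathbf z}(X\setminus W,N)\ \geqslant_{\mathbf z}\ K_{\mathbf z}(X\setminus(A\cup C),N)\cdot K_{\mathbf z}(X\setminus(B\cup D),N).$$
   Context: Let $\mathbf z=(z_0,z_1,\dots,z_N)$ be variables. For a subset $Y\subseteq X$ with the induced order, $\mathrm{PP}(Y,N)$ is the set of maps $T:Y\to\{0,1,\dots,N\}$ with $T(x)\le T(y)$ whenever $x\prec y$, and $$K_{\mathbf z}(Y,N):=\sum_{T\in\mathrm{PP}(Y,N)}z_0^{m_0(T)}z_1^{m_1(T)}\cdots z_N^{m_N(T)},\qquad m_i(T):=|T^{-1}(i)|.$$ A lower ideal is a subset closed under going down in $\prec$; an upper ideal is a subset closed under going up. For $F,G\in\mathbb R[z_0,\dots,z_N]$, $F\geqslant_{\mathbf z}G$ means that all coefficients of $F-G$ are nonnegative. *)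

theory Defs
  imports Complex_Main "HOL-Library.FuncSet" "HOL-Library.Poly_Mapping"
begin

text \<open>Real polynomials in variables \<open>z\<^sub>0, z\<^sub>1, \<dots>\<close>: a monomial is a finitely supported exponent
  function, a polynomial a finitely supported coefficient function on monomials, and
  multiplication is the convolution product of \<^theory>\<open>HOL-Library.Poly_Mapping\<close>.
  The ring \<open>\<real>[z\<^sub>0, \<dots>, z\<^sub>N]\<close> is the subring of polynomials involving only the first
  \<open>N + 1\<close> variables.\<close>

type_synonym zpoly = "(nat \<Rightarrow>\<^sub>0 nat) \<Rightarrow>\<^sub>0 real"

definition zvar :: "nat \<Rightarrow> zpoly" where
  "zvar i = Poly_Mapping.single (Poly_Mapping.single i 1) 1"

definition coeff_geq :: "zpoly \<Rightarrow> zpoly \<Rightarrow> bool" (infix "\<ge>\<^sub>z" 50) where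
  "F \<ge>\<^sub>z G \<longleftrightarrow> (\<forall>m. 0 \<le> Poly_Mapping.lookup (F - G) m)"

definition lower_ideal :: "'a set \<Rightarrow> ('a \<Rightarrow> 'a \<Rightarrow> bool) \<Rightarrow> 'a set \<Rightarrow> bool" where
  "lower_ideal X lt I \<longleftrightarrow> I \<subseteq> X \<and> (\<forall>x\<in>I. \<forall>y\<in>X. lt y x \<longrightarrow> y \<in> I)"

definition upper_ideal :: "'a set \<Rightarrow> ('a \<Rightarrow> 'a \<Rightarrow> bool) \<Rightarrow> 'a set \<Rightarrow> bool" where
  "upper_ideal X lt I \<longleftrightarrow> I \<subseteq> X \<and> (\<forall>x\<in>I. \<forall>y\<in>X. lt x y \<longrightarrow> y \<in> I)"

text \<open>Extensional functions, so that each map \<open>Y \<rightarrow> {0, \<dots>, N}\<close> is counted exactly once.\<close>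

definition PP :: "('a \<Rightarrow> 'a \<Rightarrow> bool) \<Rightarrow> 'a set \<Rightarrow> nat \<Rightarrow> ('a \<Rightarrow> nat) set" where
  "PP lt Y N = {T \<in> Y \<rightarrow>\<^sub>E {0..N}. \<forall>x\<in>Y. \<forall>y\<in>Y. lt x y \<longrightarrow> T x \<le> T y}"

definition K :: "('a \<Rightarrow> 'a \<Rightarrow> bool) \<Rightarrow> 'a set \<Rightarrow> nat \<Rightarrow> zpoly" where
  "K lt Y N = (\<Sum>T\<in>PP lt Y N. \<Prod>i\<in>{0..N}. zvar i ^ card {x \<in> Y. T x = i})"

lemma finite_PP: "finite Y \<Longrightarrow> finite (PP lt Y N)"
  unfolding PP_def by (rule finite_subset[of _ "Y \<rightarrow>\<^sub>E {0..N}"]) (auto intro: finite_PiE)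

end

theory Submission
  imports Defs
begin

text \<open>A \<open>P\<close>-partition on \<open>X - (A \<union> C)\<close>, for a lower ideal \<open>A\<close> and an upper ideal \<open>C\<close>, extends to a
  monotone map on all of \<open>X\<close> into a chain with two additional extreme values, taking the new
  least value exactly on \<open>A\<close> and the new greatest value exactly on \<open>C\<close>.  In this picture the two
  sides of the inequality count pairs \<open>(f, g)\<close> of monotone maps on \<open>X\<close> whose extreme fibres are
  prescribed, and the pair \<open>(f \<squnion> g, f \<sqinter> g)\<close> has precisely the extreme fibres belonging to
  \<open>V\<close> and \<open>W\<close>.  It also has the same weight, because the weight depends only on the unordered pair
  \<open>{f x, g x}\<close> at each point.  However, passing to \<open>(f \<squnion> g, f \<sqinter> g)\<close> is not injective.

  The remedy is to exchange values only where that is unavoidable.  Fix the pointwise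
  minimum \<open>p\<close> and maximum \<open>q\<close>.  A pair with these data amounts to a choice, at every
  point with \<open>p x < q x\<close>, of the map that receives the larger value.  Monotonicity only says that
  the choices at \<open>x \<prec> y\<close> agree if \<open>p y < q x\<close>, so the choices are made independently on the
  connected components of this relation.  A component that meets a point where the prescribed
  fibres of \<open>f\<close> and \<open>g\<close> differ admits at most one choice for \<open>(f, g)\<close>, while giving the
  larger values to the first map is always an admissible choice for the right fibres on the other
  side.  The remaining components are free on both sides.  Hence ordering the values on the forced
  components (\<open>forced\<close>) and leaving the others alone is injective
  (\<open>transfer_inj\<close>) and lands in the desired pairs (\<open>transfer_framed\<close>).\<close>

section \<open>Monotone maps with prescribed extreme fibres\<close>

definition framed ::
  "'a set \<Rightarrow> ('a \<Rightarrow> 'a \<Rightarrow> bool) \<Rightarrow> 'b::linorder \<Rightarrow> 'b \<Rightarrow> 'a set \<Rightarrow> 'a set \<Rightarrow> ('a \<Rightarrow> 'b) set" where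
  "framed X lt l u A C = {f \<in> X \<rightarrow>\<^sub>E {l..u}. (\<forall>x\<in>X. \<forall>y\<in>X. lt x y \<longrightarrow> f x \<le> f y) \<and>
     (\<forall>x\<in>X. (f x = l \<longleftrightarrow> x \<in> A) \<and> (f x = u \<longleftrightarrow> x \<in> C))}"

lemma framedI:
  assumes "\<And>x. x \<in> X \<Longrightarrow> l \<le> f x" "\<And>x. x \<in> X \<Longrightarrow> f x \<le> u" "\<And>x. x \<notin> X \<Longrightarrow> f x = undefined"
    and "\<And>x y. x \<in> X \<Longrightarrow> y \<in> X \<Longrightarrow> lt x y \<Longrightarrow> f x \<le> f y"
    and "\<And>x. x \<in> X \<Longrightarrow> f x = l \<longleftrightarrow> x \<in> A" "\<And>x. x \<in> X \<Longrightarrow> f x = u \<longleftrightarrow> x \<in> C"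
  shows "f \<in> framed X lt l u A C"
  using assms unfolding framed_def by (auto simp: PiE_iff extensional_def)

lemma framedD:
  assumes "f \<in> framed X lt l u A C"
  shows "\<And>x. x \<in> X \<Longrightarrow> l \<le> f x" "\<And>x. x \<in> X \<Longrightarrow> f x \<le> u" "\<And>x. x \<notin> X \<Longrightarrow> f x = undefined"
    and "\<And>x y. x \<in> X \<Longrightarrow> y \<in> X \<Longrightarrow> lt x y \<Longrightarrow> f x \<le> f y"
    and "\<And>x. x \<in> X \<Longrightarrow> f x = l \<longleftrightarrow> x \<in> A" "\<And>x. x \<in> X \<Longrightarrow> f x = u \<longleftrightarrow> x \<in> C"
  using assms unfolding framed_def by (auto simp: PiE_iff extensional_def)

lemma finite_framed:
  fixes l u :: nat
  shows "finite X \<Longrightarrow> finite (framed X lt l u A C)"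
  unfolding framed_def by (rule finite_subset[of _ "X \<rightarrow>\<^sub>E {l..u}"]) (auto intro: finite_PiE)

section \<open>Exchanging the values on the forced components\<close>

text \<open>The union of the components that meet \<open>S\<close>, where \<open>x \<prec> y\<close> are adjacent if a monotone map with
  values in \<open>{p, q}\<close> cannot be \<open>q\<close> at \<open>x\<close> and \<open>p\<close> at \<open>y\<close>.  For monotone \<open>p \<le> q\<close> this means
  that the half-open ranges from \<open>p\<close> to \<open>q\<close> at the two points overlap.  It is built from \<open>p\<close> and \<open>q\<close> only, so that it
  can be recovered after values of the two maps have been exchanged.\<close>

inductive_set forced ::
  "'a set \<Rightarrow> ('a \<Rightarrow> 'a \<Rightarrow> bool) \<Rightarrow> 'a set \<Rightarrow> ('a \<Rightarrow> 'b::linorder) \<Rightarrow> ('a \<Rightarrow> 'b) \<Rightarrow> 'a set"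
  for X lt S p q where
  seed: "x \<in> X \<Longrightarrow> x \<in> S \<Longrightarrow> x \<in> forced X lt S p q"
| up: "x \<in> forced X lt S p q \<Longrightarrow> y \<in> X \<Longrightarrow> lt x y \<Longrightarrow> p y < q x \<Longrightarrow> y \<in> forced X lt S p q"
| down: "y \<in> forced X lt S p q \<Longrightarrow> x \<in> X \<Longrightarrow> lt x y \<Longrightarrow> p y < q x \<Longrightarrow> x \<in> forced X lt S p q"

lemma forced_subset: "x \<in> forced X lt S p q \<Longrightarrow> x \<in> X"
  by (induction rule: forced.induct)

definition lo :: "('a \<Rightarrow> 'b::linorder) \<Rightarrow> ('a \<Rightarrow> 'b) \<Rightarrow> 'a \<Rightarrow> 'b" where
  "lo f g = (\<lambda>x. min (f x) (g x))"

definition hi :: "('a \<Rightarrow> 'b::linorder) \<Rightarrow> ('a \<Rightarrow> 'b) \<Rightarrow> 'a \<Rightarrow> 'b" where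
  "hi f g = (\<lambda>x. max (f x) (g x))"

definition transfer ::
  "'a set \<Rightarrow> ('a \<Rightarrow> 'a \<Rightarrow> bool) \<Rightarrow> 'a set \<Rightarrow> ('a \<Rightarrow> 'b::linorder) \<times> ('a \<Rightarrow> 'b) \<Rightarrow> ('a \<Rightarrow> 'b) \<times> ('a \<Rightarrow> 'b)"
  where "transfer X lt S = (\<lambda>(f, g). let R = forced X lt S (lo f g) (hi f g) in
    (\<lambda>x. if x \<in> R then hi f g x else f x, \<lambda>x. if x \<in> R then lo f g x else g x))"

lemma transfer_lo_hi:
  assumes "transfer X lt S (f, g) = (h, k)"
  shows "lo h k = lo f g" "hi h k = hi f g"
  using assms by (auto simp: transfer_def Let_def lo_def hi_def min_def max_def)

lemma transfer_values:
  assumes "transfer X lt S (f, g) = (h, k)"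
  shows "(h x = f x \<and> k x = g x) \<or> (h x = g x \<and> k x = f x)"
  using assms by (auto simp: transfer_def Let_def lo_def hi_def min_def max_def)

text \<open>At the boundary of the forced set the ranges of values do not overlap, so that all
  exchanges are compatible with the order; and off the forced set the prescribed fibres of the two
  maps coincide, hence they also coincide with the intersections and unions.\<close>

lemma transfer_framed:
  fixes f g :: "'a \<Rightarrow> 'b::linorder"
  assumes f: "f \<in> framed X lt l u A C" and g: "g \<in> framed X lt l u B D"
    and S: "S = (A - B) \<union> (B - A) \<union> (C - D) \<union> (D - C)"
    and t: "transfer X lt S (f, g) = (h, k)"
  shows "h \<in> framed X lt l u (A \<inter> B) (C \<union> D)" and "k \<in> framed X lt l u (A \<union> B) (C \<inter> D)"
proof -
  define R where "R = forced X lt S (lo f g) (hi f g)"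
  have h: "h x = (if x \<in> R then max (f x) (g x) else f x)"
    and k: "k x = (if x \<in> R then min (f x) (g x) else g x)" for x
    using t by (auto simp: transfer_def Let_def lo_def hi_def R_def)
  have out: "x \<notin> S" if "x \<in> X" "x \<notin> R" for x
    using that forced.seed unfolding R_def by metis
  have RX: "x \<notin> R" if "x \<notin> X" for x
    using that forced_subset unfolding R_def by metis
  have boundary: "max (f x) (g x) \<le> min (f y) (g y)"
    if "x \<in> X" "y \<in> X" "lt x y" "(x \<in> R) \<noteq> (y \<in> R)" for x y
    using that forced.up[of x X lt S "lo f g" "hi f g" y]
      forced.down[of y X lt S "lo f g" "hi f g" x]
    by (fold R_def) (auto simp: lo_def hi_def not_le[symmetric])
  note F = framedD[OF f] and G = framedD[OF g]
  have fib: "h x = l \<longleftrightarrow> x \<in> A \<inter> B" "h x = u \<longleftrightarrow> x \<in> C \<union> D"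
    "k x = l \<longleftrightarrow> x \<in> A \<union> B" "k x = u \<longleftrightarrow> x \<in> C \<inter> D" if x: "x \<in> X" for x
  proof -
    note * = F(1,2,5,6)[OF x] G(1,2,5,6)[OF x]
    have eqv: "x \<in> A \<longleftrightarrow> x \<in> B" "x \<in> C \<longleftrightarrow> x \<in> D" if "x \<notin> R"
      using out[OF x that] S by auto
    show "h x = l \<longleftrightarrow> x \<in> A \<inter> B" "h x = u \<longleftrightarrow> x \<in> C \<union> D"
      "k x = l \<longleftrightarrow> x \<in> A \<union> B" "k x = u \<longleftrightarrow> x \<in> C \<inter> D"
      using * eqv unfolding h k by (auto simp: min_def max_def)
  qed
  have mono: "h x \<le> h y" "k x \<le> k y" if xy: "x \<in> X" "y \<in> X" "lt x y" for x y
    using F(4)[OF xy] G(4)[OF xy] boundary[OF xy] unfolding h k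
    by (auto simp: min_def max_def split: if_splits)
  show "h \<in> framed X lt l u (A \<inter> B) (C \<union> D)"
    by (rule framedI) (use F G RX fib mono in \<open>auto simp: h le_max_iff_disj\<close>)
  show "k \<in> framed X lt l u (A \<union> B) (C \<inter> D)"
    by (rule framedI) (use F G RX fib mono in \<open>auto simp: k min_le_iff_disj\<close>)
qed

text \<open>On the forced set the prescribed fibres determine which map has the larger value at the
  points of \<open>S\<close>, and this decision propagates along adjacent points.\<close>

lemma forced_determines:
  fixes f g f' g' :: "'a \<Rightarrow> 'b::linorder"
  assumes f: "f \<in> framed X lt l u A C" and g: "g \<in> framed X lt l u B D"
    and f': "f' \<in> framed X lt l u A C" and g': "g' \<in> framed X lt l u B D"
    and p: "lo f g = lo f' g'" and q: "hi f g = hi f' g'"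
    and S: "S = (A - B) \<union> (B - A) \<union> (C - D) \<union> (D - C)"
    and x: "x \<in> forced X lt S (lo f g) (hi f g)"
  shows "f x = f' x"
proof -
  note F = framedD[OF f] and G = framedD[OF g] and F' = framedD[OF f'] and G' = framedD[OF g']
  have pq: "min (f x) (g x) = min (f' x) (g' x)" "max (f x) (g x) = max (f' x) (g' x)" for x
    using p q unfolding lo_def hi_def by metis+
  have agree: "f x = f' x \<longleftrightarrow> f y = f' y"
    if xy: "x \<in> X" "y \<in> X" "lt x y" and lt: "min (f y) (g y) < max (f x) (g x)" for x y
    using F(4)[OF xy] G(4)[OF xy] F'(4)[OF xy] G'(4)[OF xy] pq[of x] pq[of y] lt
    by (auto simp: min_def max_def split: if_splits)
  from x show ?thesis
  proof (induction rule: forced.induct)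
    case (seed x)
    note * = F(1,2,5,6)[OF seed(1)] G(1,2,5,6)[OF seed(1)] F'(1,2,5,6)[OF seed(1)]
      G'(1,2,5,6)[OF seed(1)]
    from seed(2) consider "x \<in> A" "x \<notin> B" | "x \<in> B" "x \<notin> A" | "x \<in> C" "x \<notin> D" | "x \<in> D" "x \<notin> C"
      unfolding S by blast
    then show ?case
      using * pq[of x] by cases (auto simp: min_def max_def split: if_splits)
  next
    case (up x y)
    then show ?case using agree[of x y] forced_subset[OF up(1)] by (simp add: lo_def hi_def)
  next
    case (down y x)
    then show ?case using agree[of x y] forced_subset[OF down(1)] by (simp add: lo_def hi_def)
  qed
qed

lemma transfer_inj:
  fixes l u :: "'b::linorder"
  assumes S: "S = (A - B) \<union> (B - A) \<union> (C - D) \<union> (D - C)"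
  shows "inj_on (transfer X lt S) (framed X lt l u A C \<times> framed X lt l u B D)"
proof (rule inj_onI, clarify)
  fix f g f' g' :: "'a \<Rightarrow> 'b"
  assume f: "f \<in> framed X lt l u A C" and g: "g \<in> framed X lt l u B D"
    and f': "f' \<in> framed X lt l u A C" and g': "g' \<in> framed X lt l u B D"
    and eq: "transfer X lt S (f, g) = transfer X lt S (f', g')"
  obtain h k where t: "transfer X lt S (f, g) = (h, k)" by fastforce
  have t': "transfer X lt S (f', g') = (h, k)" using t eq by simp
  have p: "lo f g = lo f' g'" and q: "hi f g = hi f' g'"
    using transfer_lo_hi[OF t] transfer_lo_hi[OF t'] by simp_all
  define R where "R = forced X lt S (lo f g) (hi f g)"
  have "f x = f' x \<and> g x = g' x" for x
  proof (cases "x \<in> R")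
    case True
    then have "f x = f' x"
      using forced_determines[OF f g f' g' p q S] unfolding R_def by blast
    moreover have "min (f x) (g x) = min (f' x) (g' x)" "max (f x) (g x) = max (f' x) (g' x)"
      using p q unfolding lo_def hi_def by metis+
    ultimately show ?thesis by (auto simp: min_def max_def split: if_splits)
  next
    case False
    have "h x = f x" "k x = g x" using t False by (auto simp: transfer_def Let_def R_def)
    moreover have "h x = f' x" "k x = g' x"
      using t' False p q by (auto simp: transfer_def Let_def R_def)
    ultimately show ?thesis by simp
  qed
  then show "f = f' \<and> g = g'" by auto
qed

section \<open>The generating function as a sum over framed maps\<close>

text \<open>The values \<open>0, \<dots>, N\<close> are shifted by one; the extreme values \<open>0\<close> and \<open>N + 2\<close> mark the
  deleted ideals and carry no variable.\<close>

definition wt :: "nat \<Rightarrow> nat \<Rightarrow> zpoly" where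
  "wt N j = (if j = 0 \<or> j = N + 2 then 1 else zvar (j - 1))"

lemma K_summand:
  assumes "finite Y" and "T \<in> PP lt Y N"
  shows "(\<Prod>i\<in>{0..N}. zvar i ^ card {x \<in> Y. T x = i}) = (\<Prod>x\<in>Y. zvar (T x))"
proof -
  have "(\<Prod>i\<in>{0..N}. zvar i ^ card {x \<in> Y. T x = i}) =
      (\<Prod>i\<in>{0..N}. \<Prod>x\<in>{x \<in> Y. T x = i}. zvar (T x))"
    by (intro prod.cong refl) simp
  also have "\<dots> = (\<Prod>x\<in>Y. zvar (T x))"
    by (rule prod.group) (use assms in \<open>auto simp: PP_def\<close>)
  finally show ?thesis .
qed

lemma K_eq_sum_framed:
  assumes X: "finite X" and A: "lower_ideal X lt A" and C: "upper_ideal X lt C"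
    and AC: "A \<inter> C = {}"
  shows "K lt (X - (A \<union> C)) N = (\<Sum>f\<in>framed X lt 0 (N + 2) A C. \<Prod>x\<in>X. wt N (f x))"
proof -
  define Y where "Y = X - (A \<union> C)"
  define i where "i f = (\<lambda>x. if x \<in> Y then f x - 1 else undefined)" for f :: "'a \<Rightarrow> nat"
  define j where "j T = (\<lambda>x. if x \<notin> X then undefined else if x \<in> A then 0
    else if x \<in> C then N + 2 else Suc (T x))" for T :: "'a \<Rightarrow> nat"
  have AX: "A \<subseteq> X" "\<And>x y. x \<in> A \<Longrightarrow> y \<in> X \<Longrightarrow> lt y x \<Longrightarrow> y \<in> A"
    using A unfolding lower_ideal_def by auto
  have CX: "C \<subseteq> X" "\<And>x y. x \<in> C \<Longrightarrow> y \<in> X \<Longrightarrow> lt x y \<Longrightarrow> y \<in> C"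
    using C unfolding upper_ideal_def by auto
  have "K lt Y N = (\<Sum>T\<in>PP lt Y N. \<Prod>x\<in>Y. zvar (T x))"
    unfolding K_def by (intro sum.cong refl K_summand) (use X in \<open>auto simp: Y_def\<close>)
  also have "\<dots> = (\<Sum>f\<in>framed X lt 0 (N + 2) A C. \<Prod>x\<in>X. wt N (f x))"
  proof (rule sum.reindex_bij_witness[of _ i j])
    fix T assume T: "T \<in> PP lt Y N"
    then have T1: "\<And>x. x \<in> Y \<Longrightarrow> T x \<le> N" "\<And>x. x \<notin> Y \<Longrightarrow> T x = undefined"
      and T2: "\<And>x y. x \<in> Y \<Longrightarrow> y \<in> Y \<Longrightarrow> lt x y \<Longrightarrow> T x \<le> T y"
      unfolding PP_def by (auto simp: PiE_iff extensional_def)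
    show "i (j T) = T"
      by (rule ext) (use T1 in \<open>auto simp: i_def j_def Y_def\<close>)
    show "j T \<in> framed X lt 0 (N + 2) A C"
    proof (rule framedI)
      fix x assume x: "x \<in> X"
      show "j T x \<le> N + 2" "j T x = N + 2 \<longleftrightarrow> x \<in> C" "j T x = 0 \<longleftrightarrow> x \<in> A"
        using x T1(1)[of x] AC by (auto simp: j_def Y_def)
    next
      fix x y assume xy: "x \<in> X" "y \<in> X" "lt x y"
      show "j T x \<le> j T y"
        using xy AX(2)[of y x] CX(2)[of x y] T1(1)[of x] T2[of x y]
        by (auto simp: j_def Y_def)
    qed (auto simp: j_def)
    have "(\<Prod>x\<in>X. wt N (j T x)) = (\<Prod>x\<in>Y. wt N (j T x))"
      by (rule prod.mono_neutral_right) (use X in \<open>auto simp: Y_def j_def wt_def\<close>)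
    also have "\<dots> = (\<Prod>x\<in>Y. zvar (T x))"
    proof (rule prod.cong)
      fix x assume "x \<in> Y"
      then show "wt N (j T x) = zvar (T x)" using T1(1)[of x] by (auto simp: Y_def j_def wt_def)
    qed simp
    finally show "(\<Prod>x\<in>X. wt N (j T x)) = (\<Prod>x\<in>Y. zvar (T x))" .
  next
    fix f assume "f \<in> framed X lt 0 (N + 2) A C"
    note F = framedD[OF this]
    have pos: "0 < f x" "f x \<le> Suc N" if "x \<in> Y" for x
      using that F(2,5,6)[of x] by (auto simp: Y_def)
    show "j (i f) = f"
    proof
      fix x
      show "j (i f) x = f x"
        using F(3,5,6)[of x] pos[of x] by (auto simp: i_def j_def Y_def)
    qed
    show "i f \<in> PP lt Y N"
      unfolding PP_def using pos F(4)
      by (auto simp: i_def PiE_iff extensional_def Y_def intro!: diff_le_mono)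
        (metis Suc_le_mono Suc_pred)+
  qed
  finally show ?thesis unfolding Y_def .
qed

section \<open>Coefficientwise comparison\<close>

lemma prod_wt_monomial:
  assumes "finite X"
  shows "\<exists>m. (\<Prod>x\<in>X. wt N (f x)) = Poly_Mapping.single m 1"
  using assms
proof (induction X rule: finite_induct)
  case empty
  show ?case by (auto intro!: exI[of _ 0] simp: single_one)
next
  case (insert x X)
  have "\<exists>m. wt N (f x) = Poly_Mapping.single m 1"
    unfolding wt_def zvar_def by (metis single_one)
  then show ?case using insert by (auto simp: mult_single)
qed

lemma sum_coeff_geq:
  assumes "finite I" and "J \<subseteq> I" and "\<And>i m. i \<in> I \<Longrightarrow> 0 \<le> Poly_Mapping.lookup (w i) m"
  shows "(\<Sum>i\<in>I. w i) \<ge>\<^sub>z (\<Sum>i\<in>J. w i)"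
proof -
  have "(\<Sum>i\<in>I. w i) - (\<Sum>i\<in>J. w i) = (\<Sum>i\<in>I - J. w i)"
    using assms(1,2) by (simp add: sum_diff)
  then show ?thesis
    unfolding coeff_geq_def using assms(3) by (auto simp: lookup_sum intro!: sum_nonneg)
qed

theorem theorem4p10:
  fixes X :: "'a set" and lt :: "'a \<Rightarrow> 'a \<Rightarrow> bool" and N :: nat
    and A B C D V W :: "'a set"
  assumes "finite X" and "irreflp_on X lt" and "transp_on X lt"
    and "lower_ideal X lt A" and "lower_ideal X lt B"
    and "upper_ideal X lt C" and "upper_ideal X lt D"
    and "A \<inter> C = {}" and "B \<inter> D = {}"
    and "V = (A \<inter> B) \<union> (C \<union> D)"
    and "W = (A \<union> B) \<union> (C \<inter> D)"
  shows "K lt (X - V) N * K lt (X - W) N \<ge>\<^sub>z K lt (X - (A \<union> C)) N * K lt (X - (B \<union> D)) N"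
proof -
  define S where "S = (A - B) \<union> (B - A) \<union> (C - D) \<union> (D - C)"
  define \<Phi> where "\<Phi> A C = framed X lt 0 (N + 2) A C" for A C
  define w where "w = (\<lambda>(f, g). (\<Prod>x\<in>X. wt N (f x)) * (\<Prod>x\<in>X. wt N (g x)))"
  let ?I = "\<Phi> (A \<inter> B) (C \<union> D) \<times> \<Phi> (A \<union> B) (C \<inter> D)" and ?J = "\<Phi> A C \<times> \<Phi> B D"
  let ?t = "transfer X lt S"
  have product: "K lt (X - (A' \<union> C')) N * K lt (X - (B' \<union> D')) N = (\<Sum>fg\<in>\<Phi> A' C' \<times> \<Phi> B' D'. w fg)"
    if "lower_ideal X lt A'" "lower_ideal X lt B'" "upper_ideal X lt C'" "upper_ideal X lt D'"
      "A' \<inter> C' = {}" "B' \<inter> D' = {}" for A' B' C' D'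
    using that assms(1)
    by (simp add: K_eq_sum_framed sum_product sum.cartesian_product \<Phi>_def w_def)
  have w_transfer: "w (?t fg) = w fg" for fg
  proof -
    obtain f g h k where fg: "fg = (f, g)" and t: "?t (f, g) = (h, k)" by (metis surj_pair)
    have "wt N (h x) * wt N (k x) = wt N (f x) * wt N (g x)" for x
      using transfer_values[OF t, of x] by (auto simp: mult.commute)
    then show ?thesis using t fg by (simp add: w_def flip: prod.distrib)
  qed
  have image: "?t ` ?J \<subseteq> ?I"
  proof clarify
    fix f g h k assume "f \<in> \<Phi> A C" "g \<in> \<Phi> B D" "(h, k) = ?t (f, g)"
    then show "h \<in> \<Phi> (A \<inter> B) (C \<union> D) \<and> k \<in> \<Phi> (A \<union> B) (C \<inter> D)"
      using transfer_framed[OF _ _ S_def] unfolding \<Phi>_def by metis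
  qed
  have nonneg: "0 \<le> Poly_Mapping.lookup (w fg) m" for fg m
  proof -
    obtain f g where fg: "fg = (f, g)" by fastforce
    obtain a b where "(\<Prod>x\<in>X. wt N (f x)) = Poly_Mapping.single a 1"
      "(\<Prod>x\<in>X. wt N (g x)) = Poly_Mapping.single b 1"
      using prod_wt_monomial[OF assms(1)] by metis
    then show ?thesis by (simp add: w_def fg mult_single lookup_single when_def)
  qed
  have "(\<Sum>fg\<in>?J. w fg) = (\<Sum>fg\<in>?J. w (?t fg))" by (simp add: w_transfer)
  also have "\<dots> = (\<Sum>fg\<in>?t ` ?J. w fg)"
    unfolding \<Phi>_def by (simp add: sum.reindex[OF transfer_inj[OF S_def]])
  finally have "(\<Sum>fg\<in>?I. w fg) \<ge>\<^sub>z (\<Sum>fg\<in>?J. w fg)"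
    using sum_coeff_geq[OF _ image nonneg] finite_framed[OF assms(1)] by (simp add: \<Phi>_def)
  moreover have "K lt (X - V) N * K lt (X - W) N = (\<Sum>fg\<in>?I. w fg)"
    unfolding assms(10,11)
    by (rule product) (use assms(4-9) in \<open>auto simp: lower_ideal_def upper_ideal_def\<close>)
  ultimately show ?thesis using product[of A B C D] assms(4-9) by simp
qed

end
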